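(* For every set of formulas $\Gamma$ and all formulas $\varphi,\psi$ of Nelson's logic $\mathcal S$: $\Gamma\cup\{\varphi\}\vdash_{\mathcal S}\psi$ if and only if $\Gamma\vdash_{\mathcal S}\varphi^2\Rightarrow\psi$, where $\varphi^2:=\neg(\varphi\Rightarrow\neg\varphi)$.
   Context: Nelson's logic $\mathcal S$ is the sentential logic in the language $\langle\land,\lor,\Rightarrow,\neg,0\rangle$ (types $2,2,2,1,0$) given by the following Hilbert-style calculus. Abbreviations: $\phi\Leftrightarrow\psi:=(\phi\Rightarrow\psi)\land(\psi\Rightarrow\phi)$, $1:=\neg 0$, $\phi\Rightarrow^2\psi:=\phi\Rightarrow(\phi\Rightarrow\psi)$; for a finite (possibly empty) list $\Gamma=(\phi_1,\dots,\phi_n)$ of formulas, $\Gamma\Rightarrow\phi:=\phi_1\Rightarrow(\phi_2\Rightarrow(\cdots(\phi_n\Rightarrow\phi)\cdots))$ and $\Gamma\Rightarrow^2\phi:=\phi_1\Rightarrow^2(\phi_2\Rightarrow^2(\cdots(\phi_n\Rightarrow^2\phi)\cdots))$, both being $\phi$ if $\Gamma$ is empty. Axiom schemata: (A1) $\phi\Rightarrow\phi$; (A2) $0\Rightarrow\psi$; (A3) $\neg\phi\Rightarrow(\phi\Rightarrow0)$; (A4) $1$; (A5) $(\phi\Rightarrow\psi)\Leftrightarrow(\neg\psi\Rightarrow\neg\phi)$. Rule schemata (for all formulas and every finite list $\Gamma$), written "premisses / conclusion": (P) $\Gamma\Rightarrow(\phi\Rightarrow(\psi\Rightarrow\gamma))$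 / $\Gamma\Rightarrow(\psi\Rightarrow(\phi\Rightarrow\gamma))$; (C) $\phi\Rightarrow(\phi\Rightarrow(\phi\Rightarrow\gamma))$ / $\phi\Rightarrow(\phi\Rightarrow\gamma)$; (E) $\Gamma\Rightarrow\phi$, $\phi\Rightarrow\gamma$ / $\Gamma\Rightarrow\gamma$; ($\Rightarrow$l) $\Gamma\Rightarrow\phi$, $\psi\Rightarrow\gamma$ / $\Gamma\Rightarrow((\phi\Rightarrow\psi)\Rightarrow\gamma)$; ($\Rightarrow$r) $\gamma$ / $\phi\Rightarrow\gamma$; ($\land$l1) $\phi\Rightarrow\gamma$ / $(\phi\land\psi)\Rightarrow\gamma$; ($\land$l2) $\psi\Rightarrow\gamma$ / $(\phi\land\psi)\Rightarrow\gamma$; ($\land$r) $\Gamma\Rightarrow\phi$, $\Gamma\Rightarrow\psi$ / $\Gamma\Rightarrow(\phi\land\psi)$; ($\lor$l1) $\phi\Rightarrow\gamma$, $\psi\Rightarrow\gamma$ / $(\phi\lor\psi)\Rightarrow\gamma$; ($\lor$l2) $\phi\Rightarrow^2\gamma$, $\psi\Rightarrow^2\gamma$ / $(\phi\lor\psi)\Rightarrow^2\gamma$; ($\lor$r1) $\Gamma\Rightarrow\phi$ / $\Gamma\Rightarrow(\phi\lor\psi)$; ($\lor$r2) $\Gamma\Rightarrow\psi$ / $\Gamma\Rightarrow(\phi\lor\psi)$; ($\neg\Rightarrow$l) $(\phi\land\neg\psi)\Rightarrow\gamma$ / $\neg(\phi\Rightarrow\psi)\Rightarrow\gamma$; ($\neg\Rightarrow$r)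 $\Gamma\Rightarrow^2(\phi\land\neg\psi)$ / $\Gamma\Rightarrow^2\neg(\phi\Rightarrow\psi)$; ($\neg\land$l) $(\neg\phi\lor\neg\psi)\Rightarrow\gamma$ / $\neg(\phi\land\psi)\Rightarrow\gamma$; ($\neg\land$r) $\Gamma\Rightarrow(\neg\phi\lor\neg\psi)$ / $\Gamma\Rightarrow\neg(\phi\land\psi)$; ($\neg\lor$l) $(\neg\phi\land\neg\psi)\Rightarrow\gamma$ / $\neg(\phi\lor\psi)\Rightarrow\gamma$; ($\neg\lor$r) $\Gamma\Rightarrow(\neg\phi\land\neg\psi)$ / $\Gamma\Rightarrow\neg(\phi\lor\psi)$; ($\neg\neg$l) $\phi\Rightarrow\gamma$ / $\neg\neg\phi\Rightarrow\gamma$; ($\neg\neg$r) $\Gamma\Rightarrow\phi$ / $\Gamma\Rightarrow\neg\neg\phi$. The consequence relation $\vdash_{\mathcal S}$ is derivability from a set of premisses by finite derivations in this calculus. *)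

theory Defs
  imports Main
begin

text \<open>
  Formulas over an arbitrary type of propositional variables. The connectives are written in
  bold to keep them apart from those of HOL.
\<close>

datatype 'v form =
    Var 'v
  | Zero (\<open>\<^bold>0\<close>)
  | Neg "'v form" (\<open>\<^bold>\<not> _\<close> [90] 90)
  | And "'v form" "'v form" (infixr \<open>\<^bold>\<and>\<close> 80)
  | Or "'v form" "'v form" (infixr \<open>\<^bold>\<or>\<close> 75)
  | Imp "'v form" "'v form" (infixr \<open>\<^bold>\<Rightarrow>\<close> 70)

abbreviation One :: "'v form" (\<open>\<^bold>1\<close>) where
  "\<^bold>1 \<equiv> \<^bold>\<not> \<^bold>0"

abbreviation Iff :: "'v form \<Rightarrow> 'v form \<Rightarrow> 'v form" (infix \<open>\<^bold>\<Leftrightarrow>\<close> 65) where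
  "\<phi> \<^bold>\<Leftrightarrow> \<psi> \<equiv> (\<phi> \<^bold>\<Rightarrow> \<psi>) \<^bold>\<and> (\<psi> \<^bold>\<Rightarrow> \<phi>)"

abbreviation Imp2 :: "'v form \<Rightarrow> 'v form \<Rightarrow> 'v form" (infixr \<open>\<^bold>\<Rightarrow>\<^sup>2\<close> 70) where
  "\<phi> \<^bold>\<Rightarrow>\<^sup>2 \<psi> \<equiv> \<phi> \<^bold>\<Rightarrow> (\<phi> \<^bold>\<Rightarrow> \<psi>)"

abbreviation Imps :: "'v form list \<Rightarrow> 'v form \<Rightarrow> 'v form" (infixr \<open>\<^bold>\<Rightarrow>\<^sub>L\<close> 68) where
  "\<Delta> \<^bold>\<Rightarrow>\<^sub>L \<phi> \<equiv> foldr Imp \<Delta> \<phi>"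

abbreviation Imps2 :: "'v form list \<Rightarrow> 'v form \<Rightarrow> 'v form" (infixr \<open>\<^bold>\<Rightarrow>\<^sup>2\<^sub>L\<close> 68) where
  "\<Delta> \<^bold>\<Rightarrow>\<^sup>2\<^sub>L \<phi> \<equiv> foldr Imp2 \<Delta> \<phi>"

text \<open>The square is the term \<open>\<not>(\<phi> \<Rightarrow> \<not>\<phi>)\<close>, and is not to be confused with \<open>\<Rightarrow>\<^sup>2\<close>.\<close>

definition Sq :: "'v form \<Rightarrow> 'v form" where
  "Sq \<phi> = \<^bold>\<not> (\<phi> \<^bold>\<Rightarrow> \<^bold>\<not> \<phi>)"

text \<open>
  \<open>\<Gamma> \<turnstile>\<^sub>S \<phi>\<close>: there is a finite derivation of \<open>\<phi>\<close> from the (possibly infinite) set \<open>\<Gamma>\<close> of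
  premisses. The rules act on arbitrary derived formulas, not only on theorems. The side
  formulas of a rule are a list \<open>\<Delta>\<close> inside a single formula and are unrelated to \<open>\<Gamma>\<close>.
\<close>

inductive derives :: "'v form set \<Rightarrow> 'v form \<Rightarrow> bool" (infix \<open>\<turnstile>\<^sub>S\<close> 50)
  for \<Gamma> :: "'v form set"
where
  premiss: "\<phi> \<in> \<Gamma> \<Longrightarrow> \<Gamma> \<turnstile>\<^sub>S \<phi>"
| A1: "\<Gamma> \<turnstile>\<^sub>S \<phi> \<^bold>\<Rightarrow> \<phi>"
| A2: "\<Gamma> \<turnstile>\<^sub>S \<^bold>0 \<^bold>\<Rightarrow> \<psi>"
| A3: "\<Gamma> \<turnstile>\<^sub>S \<^bold>\<not> \<phi> \<^bold>\<Rightarrow> (\<phi> \<^bold>\<Rightarrow> \<^bold>0)"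
| A4: "\<Gamma> \<turnstile>\<^sub>S \<^bold>1"
| A5: "\<Gamma> \<turnstile>\<^sub>S (\<phi> \<^bold>\<Rightarrow> \<psi>) \<^bold>\<Leftrightarrow> (\<^bold>\<not> \<psi> \<^bold>\<Rightarrow> \<^bold>\<not> \<phi>)"
| P: "\<Gamma> \<turnstile>\<^sub>S \<Delta> \<^bold>\<Rightarrow>\<^sub>L (\<phi> \<^bold>\<Rightarrow> (\<psi> \<^bold>\<Rightarrow> \<gamma>)) \<Longrightarrow> \<Gamma> \<turnstile>\<^sub>S \<Delta> \<^bold>\<Rightarrow>\<^sub>L (\<psi> \<^bold>\<Rightarrow> (\<phi> \<^bold>\<Rightarrow> \<gamma>))"
| C: "\<Gamma> \<turnstile>\<^sub>S \<phi> \<^bold>\<Rightarrow> (\<phi> \<^bold>\<Rightarrow> (\<phi> \<^bold>\<Rightarrow> \<gamma>)) \<Longrightarrow> \<Gamma> \<turnstile>\<^sub>S \<phi> \<^bold>\<Rightarrow> (\<phi> \<^bold>\<Rightarrow> \<gamma>)"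
| E: "\<Gamma> \<turnstile>\<^sub>S \<Delta> \<^bold>\<Rightarrow>\<^sub>L \<phi> \<Longrightarrow> \<Gamma> \<turnstile>\<^sub>S \<phi> \<^bold>\<Rightarrow> \<gamma> \<Longrightarrow> \<Gamma> \<turnstile>\<^sub>S \<Delta> \<^bold>\<Rightarrow>\<^sub>L \<gamma>"
| Imp_l: "\<Gamma> \<turnstile>\<^sub>S \<Delta> \<^bold>\<Rightarrow>\<^sub>L \<phi> \<Longrightarrow> \<Gamma> \<turnstile>\<^sub>S \<psi> \<^bold>\<Rightarrow> \<gamma> \<Longrightarrow> \<Gamma> \<turnstile>\<^sub>S \<Delta> \<^bold>\<Rightarrow>\<^sub>L ((\<phi> \<^bold>\<Rightarrow> \<psi>) \<^bold>\<Rightarrow> \<gamma>)"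
| Imp_r: "\<Gamma> \<turnstile>\<^sub>S \<gamma> \<Longrightarrow> \<Gamma> \<turnstile>\<^sub>S \<phi> \<^bold>\<Rightarrow> \<gamma>"
| And_l1: "\<Gamma> \<turnstile>\<^sub>S \<phi> \<^bold>\<Rightarrow> \<gamma> \<Longrightarrow> \<Gamma> \<turnstile>\<^sub>S (\<phi> \<^bold>\<and> \<psi>) \<^bold>\<Rightarrow> \<gamma>"
| And_l2: "\<Gamma> \<turnstile>\<^sub>S \<psi> \<^bold>\<Rightarrow> \<gamma> \<Longrightarrow> \<Gamma> \<turnstile>\<^sub>S (\<phi> \<^bold>\<and> \<psi>) \<^bold>\<Rightarrow> \<gamma>"
| And_r: "\<Gamma> \<turnstile>\<^sub>S \<Delta> \<^bold>\<Rightarrow>\<^sub>L \<phi> \<Longrightarrow> \<Gamma> \<turnstile>\<^sub>S \<Delta> \<^bold>\<Rightarrow>\<^sub>L \<psi> \<Longrightarrow> \<Gamma> \<turnstile>\<^sub>S \<Delta> \<^bold>\<Rightarrow>\<^sub>L (\<phi> \<^bold>\<and> \<psi>)"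
| Or_l1: "\<Gamma> \<turnstile>\<^sub>S \<phi> \<^bold>\<Rightarrow> \<gamma> \<Longrightarrow> \<Gamma> \<turnstile>\<^sub>S \<psi> \<^bold>\<Rightarrow> \<gamma> \<Longrightarrow> \<Gamma> \<turnstile>\<^sub>S (\<phi> \<^bold>\<or> \<psi>) \<^bold>\<Rightarrow> \<gamma>"
| Or_l2: "\<Gamma> \<turnstile>\<^sub>S \<phi> \<^bold>\<Rightarrow>\<^sup>2 \<gamma> \<Longrightarrow> \<Gamma> \<turnstile>\<^sub>S \<psi> \<^bold>\<Rightarrow>\<^sup>2 \<gamma> \<Longrightarrow> \<Gamma> \<turnstile>\<^sub>S (\<phi> \<^bold>\<or> \<psi>) \<^bold>\<Rightarrow>\<^sup>2 \<gamma>"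
| Or_r1: "\<Gamma> \<turnstile>\<^sub>S \<Delta> \<^bold>\<Rightarrow>\<^sub>L \<phi> \<Longrightarrow> \<Gamma> \<turnstile>\<^sub>S \<Delta> \<^bold>\<Rightarrow>\<^sub>L (\<phi> \<^bold>\<or> \<psi>)"
| Or_r2: "\<Gamma> \<turnstile>\<^sub>S \<Delta> \<^bold>\<Rightarrow>\<^sub>L \<psi> \<Longrightarrow> \<Gamma> \<turnstile>\<^sub>S \<Delta> \<^bold>\<Rightarrow>\<^sub>L (\<phi> \<^bold>\<or> \<psi>)"
| Neg_Imp_l: "\<Gamma> \<turnstile>\<^sub>S (\<phi> \<^bold>\<and> \<^bold>\<not> \<psi>) \<^bold>\<Rightarrow> \<gamma> \<Longrightarrow> \<Gamma> \<turnstile>\<^sub>S \<^bold>\<not> (\<phi> \<^bold>\<Rightarrow> \<psi>) \<^bold>\<Rightarrow> \<gamma>"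
| Neg_Imp_r: "\<Gamma> \<turnstile>\<^sub>S \<Delta> \<^bold>\<Rightarrow>\<^sup>2\<^sub>L (\<phi> \<^bold>\<and> \<^bold>\<not> \<psi>) \<Longrightarrow> \<Gamma> \<turnstile>\<^sub>S \<Delta> \<^bold>\<Rightarrow>\<^sup>2\<^sub>L (\<^bold>\<not> (\<phi> \<^bold>\<Rightarrow> \<psi>))"
| Neg_And_l: "\<Gamma> \<turnstile>\<^sub>S (\<^bold>\<not> \<phi> \<^bold>\<or> \<^bold>\<not> \<psi>) \<^bold>\<Rightarrow> \<gamma> \<Longrightarrow> \<Gamma> \<turnstile>\<^sub>S \<^bold>\<not> (\<phi> \<^bold>\<and> \<psi>) \<^bold>\<Rightarrow> \<gamma>"
| Neg_And_r: "\<Gamma> \<turnstile>\<^sub>S \<Delta> \<^bold>\<Rightarrow>\<^sub>L (\<^bold>\<not> \<phi> \<^bold>\<or> \<^bold>\<not> \<psi>) \<Longrightarrow> \<Gamma> \<turnstile>\<^sub>S \<Delta> \<^bold>\<Rightarrow>\<^sub>L (\<^bold>\<not> (\<phi> \<^bold>\<and> \<psi>))"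
| Neg_Or_l: "\<Gamma> \<turnstile>\<^sub>S (\<^bold>\<not> \<phi> \<^bold>\<and> \<^bold>\<not> \<psi>) \<^bold>\<Rightarrow> \<gamma> \<Longrightarrow> \<Gamma> \<turnstile>\<^sub>S \<^bold>\<not> (\<phi> \<^bold>\<or> \<psi>) \<^bold>\<Rightarrow> \<gamma>"
| Neg_Or_r: "\<Gamma> \<turnstile>\<^sub>S \<Delta> \<^bold>\<Rightarrow>\<^sub>L (\<^bold>\<not> \<phi> \<^bold>\<and> \<^bold>\<not> \<psi>) \<Longrightarrow> \<Gamma> \<turnstile>\<^sub>S \<Delta> \<^bold>\<Rightarrow>\<^sub>L (\<^bold>\<not> (\<phi> \<^bold>\<or> \<psi>))"
| Neg_Neg_l: "\<Gamma> \<turnstile>\<^sub>S \<phi> \<^bold>\<Rightarrow> \<gamma> \<Longrightarrow> \<Gamma> \<turnstile>\<^sub>S \<^bold>\<not> (\<^bold>\<not> \<phi>) \<^bold>\<Rightarrow> \<gamma>"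
| Neg_Neg_r: "\<Gamma> \<turnstile>\<^sub>S \<Delta> \<^bold>\<Rightarrow>\<^sub>L \<phi> \<Longrightarrow> \<Gamma> \<turnstile>\<^sub>S \<Delta> \<^bold>\<Rightarrow>\<^sub>L (\<^bold>\<not> (\<^bold>\<not> \<phi>))"

end

(* The forward direction reduces to the claim that \<Gamma> \<union> {\<phi>} \<turnstile> \<chi> implies \<Gamma> \<turnstile> \<phi> \<Rightarrow>\<^sup>2 \<chi>, shown by
   induction on derivations. Since permutation moves \<phi>, \<phi> through any list of side formulas, each
   rule can absorb them: a rule with a list of side formulas takes them into the list, and in a
   premiss without such a list they move to the right, into the arbitrary conclusion \<gamma>. When both
   happen at once, four copies of \<phi> result, and the contraction rule (which applies from three
   copies on) leaves two of them. Contraposition finally turns \<phi> \<Rightarrow>\<^sup>2 \<psi> into \<not>(\<phi> \<Rightarrow> \<not>\<phi>) \<Rightarrow> \<psi>. *)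

theory Submission
  imports Defs
begin

lemma derives_mono:
  assumes "\<Gamma> \<turnstile>\<^sub>S \<phi>" "\<Gamma> \<subseteq> \<Gamma>'"
  shows "\<Gamma>' \<turnstile>\<^sub>S \<phi>"
  using assms(1)
proof induction
  case (premiss \<phi>)
  then show ?case using assms(2) by (blast intro: derives.premiss)
qed (rule derives.intros; assumption)+

lemma modus_ponens: "\<Gamma> \<turnstile>\<^sub>S \<phi> \<Longrightarrow> \<Gamma> \<turnstile>\<^sub>S \<phi> \<^bold>\<Rightarrow> \<psi> \<Longrightarrow> \<Gamma> \<turnstile>\<^sub>S \<psi>"
  by (rule derives.E[of \<Gamma> "[]", simplified])

lemma contraposition: "\<Gamma> \<turnstile>\<^sub>S (\<phi> \<^bold>\<Rightarrow> \<psi>) \<^bold>\<Rightarrow> (\<^bold>\<not> \<psi> \<^bold>\<Rightarrow> \<^bold>\<not> \<phi>)"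
  by (rule modus_ponens[OF derives.A5 derives.And_l1[OF derives.A1]])

lemma P_iff:
  "\<Gamma> \<turnstile>\<^sub>S \<Delta> \<^bold>\<Rightarrow>\<^sub>L (\<phi> \<^bold>\<Rightarrow> (\<psi> \<^bold>\<Rightarrow> \<gamma>)) \<longleftrightarrow> \<Gamma> \<turnstile>\<^sub>S \<Delta> \<^bold>\<Rightarrow>\<^sub>L (\<psi> \<^bold>\<Rightarrow> (\<phi> \<^bold>\<Rightarrow> \<gamma>))"
  by (rule iffI; erule derives.P)

text \<open>The prefix \<open>\<Delta>'\<close> is there for the induction: each formula of
  \<open>\<Delta>\<close> that \<open>\<phi>\<close> has passed joins the prefix, under which rule
  (P) still permits a swap.\<close>

lemma Imps_permute_prefix:
  "\<Gamma> \<turnstile>\<^sub>S \<Delta>' \<^bold>\<Rightarrow>\<^sub>L (\<Delta> \<^bold>\<Rightarrow>\<^sub>L (\<phi> \<^bold>\<Rightarrow> \<gamma>)) \<longleftrightarrow> \<Gamma> \<turnstile>\<^sub>S \<Delta>' \<^bold>\<Rightarrow>\<^sub>L (\<phi> \<^bold>\<Rightarrow> (\<Delta> \<^bold>\<Rightarrow>\<^sub>L \<gamma>))"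
proof (induction \<Delta> arbitrary: \<Delta>')
  case (Cons \<delta> \<Delta>)
  show ?case
    using Cons[of "\<Delta>' @ [\<delta>]"] P_iff[of \<Gamma> \<Delta>' \<delta> \<phi> "\<Delta> \<^bold>\<Rightarrow>\<^sub>L \<gamma>"] by simp
qed simp

lemma Imps_Imp2_permute: "\<Gamma> \<turnstile>\<^sub>S \<Delta> \<^bold>\<Rightarrow>\<^sub>L (\<phi> \<^bold>\<Rightarrow>\<^sup>2 \<gamma>) \<longleftrightarrow> \<Gamma> \<turnstile>\<^sub>S \<phi> \<^bold>\<Rightarrow>\<^sup>2 (\<Delta> \<^bold>\<Rightarrow>\<^sub>L \<gamma>)"
  using Imps_permute_prefix[of \<Gamma> "[]" \<Delta> \<phi> "\<phi> \<^bold>\<Rightarrow> \<gamma>"] Imps_permute_prefix[of \<Gamma> "[\<phi>]" \<Delta> \<phi> \<gamma>]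
  by simp

text \<open>The \<open>right\<close> versions move a doubled \<phi> behind an antecedent, so that a
  left rule sees it as part of its arbitrary conclusion; the \<open>left\<close> versions bring it
  back to the front.\<close>

lemmas Imp_Imp2_permute = Imps_Imp2_permute[where \<Delta> = "[\<delta>]" for \<delta>, simplified]
lemmas Imp2_right = Imp_Imp2_permute[THEN iffD2]
lemmas Imp2_left = Imp_Imp2_permute[THEN iffD1]

lemmas Imp2_Imp2_permute = Imps_Imp2_permute[where \<Delta> = "[\<delta>, \<delta>]" for \<delta>, simplified]
lemmas Imp2_Imp2_right = Imp2_Imp2_permute[THEN iffD2]
lemmas Imp2_Imp2_left = Imp2_Imp2_permute[THEN iffD1]

text \<open>Moving the inner pair to the front gives four adjacent copies of \<phi>; two uses of (C)
  reduce them to three and then to two.\<close>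

lemma Imp2_contract:
  assumes "\<Gamma> \<turnstile>\<^sub>S \<phi> \<^bold>\<Rightarrow>\<^sup>2 (\<Delta> \<^bold>\<Rightarrow>\<^sub>L (\<phi> \<^bold>\<Rightarrow>\<^sup>2 \<gamma>))"
  shows "\<Gamma> \<turnstile>\<^sub>S \<phi> \<^bold>\<Rightarrow>\<^sup>2 (\<Delta> \<^bold>\<Rightarrow>\<^sub>L \<gamma>)"
proof -
  have "\<Gamma> \<turnstile>\<^sub>S \<phi> \<^bold>\<Rightarrow>\<^sup>2 (\<phi> \<^bold>\<Rightarrow>\<^sup>2 (\<Delta> \<^bold>\<Rightarrow>\<^sub>L \<gamma>))"
    using assms Imps_Imp2_permute[of \<Gamma> "\<phi> # \<phi> # \<Delta>" \<phi> \<gamma>] by simp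
  then show ?thesis by (rule derives.C[OF derives.C])
qed

lemma deduction_Imp2:
  assumes "insert \<phi> \<Gamma> \<turnstile>\<^sub>S \<chi>"
  shows "\<Gamma> \<turnstile>\<^sub>S \<phi> \<^bold>\<Rightarrow>\<^sup>2 \<chi>"
  using assms
proof induction
  case (premiss \<chi>)
  \<comment> \<open>Either \<chi> is \<phi> and (A1) is weakened once, or \<chi> lies in \<Gamma>
    and is weakened twice.\<close>
  then show ?case by (auto intro: derives.Imp_r derives.A1 derives.premiss)
next
  case (P \<Delta> \<alpha> \<beta> \<gamma>)
  then show ?case using derives.P[of \<Gamma> "\<phi> # \<phi> # \<Delta>" \<alpha> \<beta> \<gamma>] by simp
next
  case (C \<alpha> \<gamma>)
  then have "\<Gamma> \<turnstile>\<^sub>S \<alpha> \<^bold>\<Rightarrow> (\<alpha> \<^bold>\<Rightarrow>\<^sup>2 (\<phi> \<^bold>\<Rightarrow>\<^sup>2 \<gamma>))"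
    using Imps_Imp2_permute[of \<Gamma> "[\<alpha>, \<alpha>, \<alpha>]" \<phi> \<gamma>] by simp
  then show ?case by (rule Imp2_Imp2_left[OF derives.C])
next
  case (E \<Delta> \<alpha> \<gamma>)
  have "\<Gamma> \<turnstile>\<^sub>S \<alpha> \<^bold>\<Rightarrow> (\<phi> \<^bold>\<Rightarrow>\<^sup>2 \<gamma>)"
    using E.IH(2) by (rule Imp2_right)
  then show ?case
    using E.IH(1) derives.E[of \<Gamma> "\<phi> # \<phi> # \<Delta>" \<alpha> "\<phi> \<^bold>\<Rightarrow>\<^sup>2 \<gamma>"]
      Imp2_contract[of \<Gamma> \<phi> \<Delta> \<gamma>]
    by simp
next
  case (Imp_l \<Delta> \<alpha> \<beta> \<gamma>)
  have "\<Gamma> \<turnstile>\<^sub>S \<beta> \<^bold>\<Rightarrow> (\<phi> \<^bold>\<Rightarrow>\<^sup>2 \<gamma>)"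
    using Imp_l.IH(2) by (rule Imp2_right)
  \<comment> \<open>The principal formula stands between the two pairs of \<phi>, so the contraction
    has to pass over it as well as over \<open>\<Delta>\<close>.\<close>
  then show ?case
    using Imp_l.IH(1) derives.Imp_l[of \<Gamma> "\<phi> # \<phi> # \<Delta>" \<alpha> \<beta> "\<phi> \<^bold>\<Rightarrow>\<^sup>2 \<gamma>"]
      Imp2_contract[of \<Gamma> \<phi> "\<Delta> @ [\<alpha> \<^bold>\<Rightarrow> \<beta>]" \<gamma>]
    by simp
next
  case (Imp_r \<gamma> \<alpha>)
  show ?case using Imp_r.IH by (rule Imp2_left[OF derives.Imp_r])
next
  case (And_r \<Delta> \<alpha> \<beta>)
  then show ?case using derives.And_r[of \<Gamma> "\<phi> # \<phi> # \<Delta>" \<alpha> \<beta>] by simp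
next
  case (Or_l1 \<alpha> \<gamma> \<beta>)
  show ?case using Or_l1.IH
    by (rule Imp2_left[OF derives.Or_l1[OF Imp2_right Imp2_right]])
next
  case (Or_l2 \<alpha> \<gamma> \<beta>)
  \<comment> \<open>The disjuncts occur doubled here, so both copies must be permuted past the pair
    of \<phi>.\<close>
  show ?case using Or_l2.IH
    by (rule Imp2_Imp2_left[OF derives.Or_l2[OF Imp2_Imp2_right Imp2_Imp2_right]])
next
  case (Or_r1 \<Delta> \<alpha> \<beta>)
  then show ?case using derives.Or_r1[of \<Gamma> "\<phi> # \<phi> # \<Delta>" \<alpha> \<beta>] by simp
next
  case (Or_r2 \<Delta> \<beta> \<alpha>)
  then show ?case using derives.Or_r2[of \<Gamma> "\<phi> # \<phi> # \<Delta>" \<beta> \<alpha>] by simp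
next
  case (Neg_Imp_r \<Delta> \<alpha> \<beta>)
  \<comment> \<open>One entry \<phi> suffices: this rule doubles every formula of its list.\<close>
  then show ?case using derives.Neg_Imp_r[of \<Gamma> "\<phi> # \<Delta>" \<alpha> \<beta>] by simp
next
  case (Neg_And_r \<Delta> \<alpha> \<beta>)
  then show ?case using derives.Neg_And_r[of \<Gamma> "\<phi> # \<phi> # \<Delta>" \<alpha> \<beta>] by simp
next
  case (Neg_Or_r \<Delta> \<alpha> \<beta>)
  then show ?case using derives.Neg_Or_r[of \<Gamma> "\<phi> # \<phi> # \<Delta>" \<alpha> \<beta>] by simp
next
  case (Neg_Neg_r \<Delta> \<alpha>)
  then show ?case using derives.Neg_Neg_r[of \<Gamma> "\<phi> # \<phi> # \<Delta>" \<alpha>] by simp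
next
  case And_l1
  show ?case using And_l1.IH by (rule Imp2_left[OF derives.And_l1[OF Imp2_right]])
next
  case And_l2
  show ?case using And_l2.IH by (rule Imp2_left[OF derives.And_l2[OF Imp2_right]])
next
  case Neg_Imp_l
  show ?case using Neg_Imp_l.IH by (rule Imp2_left[OF derives.Neg_Imp_l[OF Imp2_right]])
next
  case Neg_And_l
  show ?case using Neg_And_l.IH by (rule Imp2_left[OF derives.Neg_And_l[OF Imp2_right]])
next
  case Neg_Or_l
  show ?case using Neg_Or_l.IH by (rule Imp2_left[OF derives.Neg_Or_l[OF Imp2_right]])
next
  case Neg_Neg_l
  show ?case using Neg_Neg_l.IH by (rule Imp2_left[OF derives.Neg_Neg_l[OF Imp2_right]])
\<comment> \<open>Only the axioms remain, each weakened twice by \<phi>.\<close>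
qed (rule derives.Imp_r[OF derives.Imp_r],
    rule derives.A1 derives.A2 derives.A3 derives.A4 derives.A5)+

text \<open>Contraposing the inner implication and permuting gives \<not>\<psi> \<Rightarrow>
  (\<phi> \<Rightarrow> \<not>\<phi>). A second contraposition has the square as antecedent and
  \<not>\<not>\<psi> as conclusion.\<close>

lemma Imp2_imp_Sq:
  assumes "\<Gamma> \<turnstile>\<^sub>S \<phi> \<^bold>\<Rightarrow>\<^sup>2 \<psi>"
  shows "\<Gamma> \<turnstile>\<^sub>S Sq \<phi> \<^bold>\<Rightarrow> \<psi>"
proof -
  have "\<Gamma> \<turnstile>\<^sub>S \<phi> \<^bold>\<Rightarrow> (\<^bold>\<not> \<psi> \<^bold>\<Rightarrow> \<^bold>\<not> \<phi>)"
    using assms derives.E[of \<Gamma> "[\<phi>]", OF _ contraposition, of \<phi> \<psi>] by simp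
  then have "\<Gamma> \<turnstile>\<^sub>S \<^bold>\<not> \<psi> \<^bold>\<Rightarrow> (\<phi> \<^bold>\<Rightarrow> \<^bold>\<not> \<phi>)"
    by (rule derives.P[of \<Gamma> "[]", simplified])
  then have "\<Gamma> \<turnstile>\<^sub>S Sq \<phi> \<^bold>\<Rightarrow> \<^bold>\<not> (\<^bold>\<not> \<psi>)"
    unfolding Sq_def by (rule modus_ponens[OF _ contraposition])
  then show ?thesis
    using derives.E[of \<Gamma> "[Sq \<phi>]", OF _ derives.Neg_Neg_l[OF derives.A1], of \<psi>] by simp
qed

text \<open>With an empty list of side formulas, the right rule for negated implication turns \<phi>
  \<and> \<not>\<not>\<phi> into the square.\<close>

lemma derives_Sq:
  assumes "\<Gamma> \<turnstile>\<^sub>S \<phi>"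
  shows "\<Gamma> \<turnstile>\<^sub>S Sq \<phi>"
  using assms derives.Neg_Neg_r[of \<Gamma> "[]" \<phi>] derives.And_r[of \<Gamma> "[]" \<phi> "\<^bold>\<not> (\<^bold>\<not> \<phi>)"]
    derives.Neg_Imp_r[of \<Gamma> "[]" \<phi> "\<^bold>\<not> \<phi>"]
  by (simp add: Sq_def)

theorem theorem4p4:
  fixes \<Gamma> :: "'v form set" and \<phi> \<psi> :: "'v form"
  shows "\<Gamma> \<union> {\<phi>} \<turnstile>\<^sub>S \<psi> \<longleftrightarrow> \<Gamma> \<turnstile>\<^sub>S (Sq \<phi> \<^bold>\<Rightarrow> \<psi>)"
proof
  assume "\<Gamma> \<union> {\<phi>} \<turnstile>\<^sub>S \<psi>"
  then show "\<Gamma> \<turnstile>\<^sub>S Sq \<phi> \<^bold>\<Rightarrow> \<psi>" by (simp add: Imp2_imp_Sq deduction_Imp2)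
next
  assume "\<Gamma> \<turnstile>\<^sub>S Sq \<phi> \<^bold>\<Rightarrow> \<psi>"
  then have "\<Gamma> \<union> {\<phi>} \<turnstile>\<^sub>S Sq \<phi> \<^bold>\<Rightarrow> \<psi>" by (rule derives_mono) blast
  moreover have "\<Gamma> \<union> {\<phi>} \<turnstile>\<^sub>S Sq \<phi>" by (simp add: derives_Sq derives.premiss)
  ultimately show "\<Gamma> \<union> {\<phi>} \<turnstile>\<^sub>S \<psi>" by (rule modus_ponens[rotated])
qed

end
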